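(* Let $p>3$ be a prime. Then $$\sum_{k=0}^{p-1}\binom{-1/3}k(-2)^k\equiv \Big(\frac{-3}p\Big)+\frac{3-\big(\frac{-3}p\big)}3pq_p(2)\pmod{p^2}.$$
   Context: For $x,y\in\mathbb Q$ with denominators prime to $p$, $x\equiv y\pmod{p^m}$ means $(x-y)/p^m$ has denominator prime to $p$. For rational $a$ and integer $k\ge0$, $\binom ak=a(a-1)\cdots(a-k+1)/k!$. $q_p(2)=(2^{p-1}-1)/p$ is the Fermat quotient, $\big(\frac{-3}p\big)$ the Legendre symbol. *)

theory Defs
  imports Complex_Main "HOL-Number_Theory.Number_Theory"
begin

definition p_integral :: "nat \<Rightarrow> rat \<Rightarrow> bool"
  where "p_integral p x \<longleftrightarrow> coprime (snd (quotient_of x)) (int p)"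

(* The congruence is only meaningful for x and y with denominators prime to p,
   so this requirement is part of the relation. *)
definition rat_cong :: "nat \<Rightarrow> nat \<Rightarrow> rat \<Rightarrow> rat \<Rightarrow> bool"
  where "rat_cong p m x y \<longleftrightarrow>
    p_integral p x \<and> p_integral p y \<and> p_integral p ((x - y) / of_nat p ^ m)"

(* Rational-valued, so that the quotient is exact division for every p and a. *)
definition fermat_quotient :: "nat \<Rightarrow> int \<Rightarrow> rat"
  where "fermat_quotient p a = (of_int a ^ (p - 1) - 1) / of_nat p"

end

theory Submission
  imports Defs
begin

text \<open>Let \<open>f a\<close> be the sum with \<open>-1/3\<close> replaced by \<open>a\<close>. Pascal's rule gives
  \<open>f (a + 1) + f a = 2 ^ p * (a gchoose (p - 1))\<close>, and for \<open>a = p * t + n\<close> the right-hand side is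
  \<open>2 * t * (-1) ^ n * (p choose (n + 1))\<close> modulo \<open>p ^ 2\<close>. Moreover \<open>p * t gchoose k\<close> is congruent to
  \<open>t * (p choose k)\<close>, so \<open>f (p * t)\<close> is congruent to \<open>1 + t * (2 ^ p - 2)\<close>. Hence \<open>f (p * t + n)\<close> is
  determined by the partial sum of \<open>p choose j\<close> over \<open>1 \<le> j \<le> n\<close>. For \<open>a = -1/3\<close> one has
  \<open>n = p div 3\<close> or \<open>n = p - 1 - p div 3\<close>, and these partial sums reduce to the sum of all \<open>p choose k\<close>
  with \<open>3 dvd k\<close>, which is known exactly.\<close>

section \<open>Congruences of rationals with denominators prime to p\<close>

text \<open>The reduced denominator divides every other denominator, so any fraction representing
  \<open>x\<close> may serve as witness. This spares the closure proofs below any computation of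
  normal forms.\<close>

lemma p_integral_iff:
  "p_integral p x \<longleftrightarrow> (\<exists>a b. b \<noteq> 0 \<and> coprime b (int p) \<and> x = of_int a / of_int b)"
proof
  assume "p_integral p x"
  then show "\<exists>a b. b \<noteq> 0 \<and> coprime b (int p) \<and> x = of_int a / of_int b"
    unfolding p_integral_def using quotient_of_denom_pos'[of x]
    by (metis less_irrefl prod.collapse quotient_of_div)
next
  assume "\<exists>a b. b \<noteq> 0 \<and> coprime b (int p) \<and> x = of_int a / of_int b"
  then obtain a b where b: "b \<noteq> 0" "coprime b (int p)" and x: "x = of_int a / of_int b"
    by blast
  obtain c d where q: "quotient_of x = (c, d)" by force
  have d: "d > 0" "coprime c d" "x = of_int c / of_int d"
    using quotient_of_denom_pos[OF q] quotient_of_coprime[OF q] quotient_of_div[OF q] by blast+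
  have "(of_int (c * b) :: rat) = of_int (a * d)"
    using x d b by (simp add: field_simps)
  then have "c * b = a * d" by (simp only: of_int_eq_iff)
  then have "d dvd c * b" by simp
  then have "d dvd b" using d by (metis coprime_commute coprime_dvd_mult_right_iff)
  then show "p_integral p x"
    unfolding p_integral_def using b q coprime_divisors[of d b "int p" "int p"] by simp
qed

lemma p_integral_of_int [simp, intro]: "p_integral p (of_int a)"
  unfolding p_integral_iff by (intro exI[of _ a] exI[of _ 1]) auto

lemma p_integral_of_nat [simp, intro]: "p_integral p (of_nat a)"
  using p_integral_of_int[of p "int a"] by simp

lemma p_integral_numeral [simp, intro]:
  "p_integral p 0" "p_integral p 1" "p_integral p (numeral n)"
  using p_integral_of_int[of p 0] p_integral_of_int[of p 1] p_integral_of_int[of p "numeral n"]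
  by simp_all

lemma p_integral_add [intro]:
  assumes "p_integral p x" "p_integral p y"
  shows "p_integral p (x + y)"
proof -
  obtain a b c d where "b \<noteq> 0" "coprime b (int p)" "x = of_int a / of_int b"
    "d \<noteq> 0" "coprime d (int p)" "y = of_int c / of_int d"
    using assms unfolding p_integral_iff by blast
  then show ?thesis
    unfolding p_integral_iff
    by (intro exI[of _ "a * d + c * b"] exI[of _ "b * d"]) (simp add: add_frac_eq)
qed

lemma p_integral_mult [intro]:
  assumes "p_integral p x" "p_integral p y"
  shows "p_integral p (x * y)"
proof -
  obtain a b c d where "b \<noteq> 0" "coprime b (int p)" "x = of_int a / of_int b"
    "d \<noteq> 0" "coprime d (int p)" "y = of_int c / of_int d"
    using assms unfolding p_integral_iff by blast
  then show ?thesis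
    unfolding p_integral_iff
    by (intro exI[of _ "a * c"] exI[of _ "b * d"]) simp
qed

lemma p_integral_minus [intro]: "p_integral p x \<Longrightarrow> p_integral p (- x)"
  using p_integral_mult[OF p_integral_of_int[of p "-1"], of x] by simp

lemma p_integral_diff [intro]:
  "p_integral p x \<Longrightarrow> p_integral p y \<Longrightarrow> p_integral p (x - y)"
  using p_integral_add[of p x "- y"] by auto

lemma p_integral_power [intro]: "p_integral p x \<Longrightarrow> p_integral p (x ^ n)"
  by (induction n) auto

lemma p_integral_prod [intro]:
  "(\<And>i. i \<in> A \<Longrightarrow> p_integral p (f i)) \<Longrightarrow> p_integral p (prod f A)"
  by (induction A rule: infinite_finite_induct) auto

lemma p_integral_inverse_int:
  assumes "coprime b (int p)"
  shows "p_integral p (1 / of_int b)"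
proof (cases "b = 0")
  case False
  with assms show ?thesis unfolding p_integral_iff by (intro exI[of _ 1] exI[of _ b]) auto
qed auto

lemma p_integral_inverse_nat:
  assumes "prime p" "k > 0" "k < p"
  shows "p_integral p (1 / of_nat k)"
proof -
  have "coprime k p"
    using assms by (metis coprime_commute nat_dvd_not_less prime_imp_coprime)
  then show ?thesis using p_integral_inverse_int[of "int k" p] by simp
qed

lemma p_integral_inverse_fact:
  assumes "prime p" "k < p"
  shows "p_integral p (1 / fact k)"
proof -
  have "coprime (fact k) p"
    using assms by (metis coprime_commute linorder_not_le prime_dvd_fact_iff prime_imp_coprime)
  then have "coprime (int (fact k)) (int p)" by (simp only: coprime_int_iff)
  from p_integral_inverse_int[OF this] show ?thesis by simp
qed

section \<open>Congruence modulo \<open>p ^ m\<close> and its compatibility with arithmetic\<close>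

lemma rat_cong_integral:
  assumes "rat_cong p m x y"
  shows "p_integral p x" "p_integral p y"
  using assms by (auto simp: rat_cong_def)

lemma rat_cong_refl [intro]: "p_integral p x \<Longrightarrow> rat_cong p m x x"
  by (auto simp: rat_cong_def)

lemma rat_cong_sym: "rat_cong p m x y \<Longrightarrow> rat_cong p m y x"
  unfolding rat_cong_def by (metis minus_diff_eq minus_divide_left p_integral_minus)

lemma rat_cong_trans [trans]:
  assumes "rat_cong p m x y" "rat_cong p m y z"
  shows "rat_cong p m x z"
proof -
  have "(x - z) / of_nat p ^ m = (x - y) / of_nat p ^ m + (y - z) / of_nat p ^ m"
    by (simp add: diff_divide_distrib)
  then show ?thesis using assms unfolding rat_cong_def by (metis p_integral_add)
qed

lemma rat_cong_add:
  assumes "rat_cong p m x y" "rat_cong p m x' y'"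
  shows "rat_cong p m (x + x') (y + y')"
proof -
  have "(x + x' - (y + y')) / of_nat p ^ m = (x - y) / of_nat p ^ m + (x' - y') / of_nat p ^ m"
    by (simp add: diff_divide_distrib add_divide_distrib)
  then show ?thesis using assms unfolding rat_cong_def by (metis p_integral_add)
qed

text \<open>The difference of products splits as \<open>x * (x' - y') + y' * (x - y)\<close>; the
  integrality of \<open>x\<close> and \<open>y'\<close> comes from the relation itself.\<close>

lemma rat_cong_mult:
  assumes "rat_cong p m x y" "rat_cong p m x' y'"
  shows "rat_cong p m (x * x') (y * y')"
proof -
  have "(x * x' - y * y') / of_nat p ^ m
      = x * ((x' - y') / of_nat p ^ m) + y' * ((x - y) / of_nat p ^ m)"
    by (simp add: diff_divide_distrib algebra_simps)
  then show ?thesis using assms unfolding rat_cong_def by (metis p_integral_add p_integral_mult)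
qed

lemma rat_cong_minus: "rat_cong p m x y \<Longrightarrow> rat_cong p m (- x) (- y)"
  using rat_cong_mult[of p m "-1" "-1" x y] by auto

lemma rat_cong_sum:
  "(\<And>i. i \<in> A \<Longrightarrow> rat_cong p m (f i) (g i)) \<Longrightarrow> rat_cong p m (sum f A) (sum g A)"
  by (induction A rule: infinite_finite_induct) (auto intro: rat_cong_add)

lemma rat_cong_prod:
  "(\<And>i. i \<in> A \<Longrightarrow> rat_cong p m (f i) (g i)) \<Longrightarrow> rat_cong p m (prod f A) (prod g A)"
  by (induction A rule: infinite_finite_induct) (auto intro: rat_cong_mult)

text \<open>Once a factor \<open>p\<close> is split off exactly, the cofactor need only be known
  modulo \<open>p\<close> to obtain a congruence modulo \<open>p ^ 2\<close>.\<close>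

lemma rat_cong_Suc:
  "rat_cong p m x y \<Longrightarrow> rat_cong p (Suc m) (of_nat p * x) (of_nat p * y)"
  unfolding rat_cong_def
  by (cases "p = 0") (auto simp flip: right_diff_distrib)

lemma rat_cong_of_int:
  assumes "[a = b] (mod int p ^ m)"
  shows "rat_cong p m (of_int a) (of_int b)"
proof -
  obtain k where "a - b = int p ^ m * k"
    using assms by (metis cong_iff_dvd_diff dvdE)
  then have "(of_int a - of_int b :: rat) = of_nat p ^ m * of_int k"
    by (metis of_int_diff of_int_mult of_int_of_nat_eq of_int_power)
  then show ?thesis
    unfolding rat_cong_def by (cases "(of_nat p :: rat) ^ m = 0") auto
qed

lemma rat_cong_add_multiple:
  assumes "p_integral p x" "p_integral p y"
  shows "rat_cong p 1 (of_nat p * x + y) y"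
  using assms unfolding rat_cong_def by (cases "p = 0") auto

lemma rat_cong_inverse:
  assumes "rat_cong p m x y" "p_integral p (1 / x)" "p_integral p (1 / y)" "x \<noteq> 0" "y \<noteq> 0"
  shows "rat_cong p m (1 / x) (1 / y)"
proof -
  \<comment> \<open>Multiplying by \<open>1 / x * (1 / y)\<close> turns \<open>x\<close> into
    \<open>1 / y\<close> and \<open>y\<close> into \<open>1 / x\<close>, so symmetry is applied at
    the end.\<close>
  have "rat_cong p m (x * (1 / x * (1 / y))) (y * (1 / x * (1 / y)))"
    using assms by (intro rat_cong_mult) auto
  then show ?thesis using assms by (auto intro: rat_cong_sym)
qed

text \<open>For \<open>k < p\<close> the binomial coefficient is a polynomial in its upper argument
  whose only denominator, \<open>fact k\<close>, is prime to \<open>p\<close>.\<close>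

lemma rat_cong_gbinomial:
  assumes "prime p" "k < p" "rat_cong p m x y"
  shows "rat_cong p m (x gchoose k) (y gchoose k)"
proof -
  have "rat_cong p m (1 / fact k * (\<Prod>i = 0..<k. x - of_nat i))
          (1 / fact k * (\<Prod>i = 0..<k. y - of_nat i))"
    using assms p_integral_inverse_fact[of p k]
      rat_cong_add[OF _ rat_cong_refl[OF p_integral_minus[OF p_integral_of_nat]], of p m x y]
    by (intro rat_cong_mult rat_cong_prod) auto
  then show ?thesis by (simp add: gbinomial_prod_rev)
qed

section \<open>Binomial coefficients modulo the square of p\<close>

text \<open>Absorption extracts the factor \<open>p * t / k\<close> and leaves
  \<open>p * t - 1 gchoose (k - 1)\<close>, whose upper argument is -1 modulo \<open>p\<close>. The
  factorisation is kept as an equality so that later steps can rescale the cofactor modulo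
  \<open>p\<close>.\<close>

lemma gbinomial_multiple_p_cong:
  assumes p: "prime p" and t: "p_integral p t" and k: "0 < k" "k < p"
  shows "\<exists>c. rat_cong p 1 c ((-1) ^ (k - 1) / of_nat k)
    \<and> (of_nat p * t gchoose k) = of_nat p * (t * c)"
proof (intro exI conjI)
  have "rat_cong p 1 (of_nat p * t + (-1) gchoose (k - 1)) ((-1) gchoose (k - 1))"
    using k by (intro rat_cong_gbinomial p rat_cong_add_multiple t) auto
  moreover have "((-1 :: rat) gchoose (k - 1)) = (-1) ^ (k - 1)"
    using gbinomial_minus[of "1 :: rat" "k - 1"] binomial_gbinomial[of "k - 1" "k - 1", where ?'a = rat]
    by simp
  ultimately have "rat_cong p 1 (of_nat p * t - 1 gchoose (k - 1)) ((-1) ^ (k - 1))" by simp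
  from rat_cong_mult[OF rat_cong_refl[OF p_integral_inverse_nat[OF p k]] this]
  show "rat_cong p 1 (1 / of_nat k * (of_nat p * t - 1 gchoose (k - 1))) ((-1) ^ (k - 1) / of_nat k)"
    by simp
  show "(of_nat p * t gchoose k)
      = of_nat p * (t * (1 / of_nat k * (of_nat p * t - 1 gchoose (k - 1))))"
    using k gbinomial_absorption'[of k "of_nat p * t"] by simp
qed

lemma gbinomial_multiple_p_cong2:
  assumes "prime p" "p_integral p t" "0 < k" "k < p"
  shows "rat_cong p 2 (of_nat p * t gchoose k) (of_nat p * (t * ((-1) ^ (k - 1) / of_nat k)))"
proof -
  obtain c where c: "rat_cong p 1 c ((-1) ^ (k - 1) / of_nat k)"
    "(of_nat p * t gchoose k) = of_nat p * (t * c)"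
    using gbinomial_multiple_p_cong[OF assms] by blast
  have "rat_cong p (Suc 1) (of_nat p * (t * c)) (of_nat p * (t * ((-1) ^ (k - 1) / of_nat k)))"
    by (intro rat_cong_Suc rat_cong_mult c(1) rat_cong_refl assms)
  then show ?thesis by (simp add: c(2) numeral_2_eq_2)
qed

lemma binomial_p_cong:
  assumes "prime p" "0 < k" "k < p"
  shows "rat_cong p 2 (of_nat (p choose k)) (of_nat p * ((-1) ^ (k - 1) / of_nat k))"
  using gbinomial_multiple_p_cong2[OF assms(1) _ assms(2,3), of 1] by (simp add: binomial_gbinomial)

text \<open>Both sides reduce to the same multiple of \<open>p\<close>: modulo \<open>p ^ 2\<close>
  the dependence on \<open>t\<close> is linear.\<close>

lemma gbinomial_multiple_p_cong_binomial:
  assumes "prime p" "p_integral p t" "0 < k" "k < p"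
  shows "rat_cong p 2 (of_nat p * t gchoose k) (t * of_nat (p choose k))"
proof -
  have "rat_cong p 2 (t * of_nat (p choose k)) (t * (of_nat p * ((-1) ^ (k - 1) / of_nat k)))"
    using assms by (intro rat_cong_mult binomial_p_cong) auto
  from rat_cong_trans[OF gbinomial_multiple_p_cong2[OF assms], OF rat_cong_sym] this
  show ?thesis by (simp add: mult.left_commute)
qed

text \<open>Raising \<open>a = p * t + n\<close> by one multiplies the coefficient by
  \<open>(a + 1) / (a + 2 - p)\<close>, which is \<open>(n + 1) / (n + 2)\<close> modulo
  \<open>p\<close>. The bound on \<open>n\<close> keeps these numbers units, so the products
  telescope to \<open>1 / (n + 1)\<close>.\<close>

lemma gbinomial_top_cong:
  assumes p: "prime p" "p > 3" and t: "p_integral p t" and n: "n + 1 < p"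
  shows "\<exists>c. rat_cong p 1 c (1 / of_nat (n + 1))
    \<and> (of_nat p * t + of_nat n gchoose (p - 1)) = of_nat p * (t * c)"
  using n
proof (induction n)
  case 0
  have "odd p" using p by (simp add: prime_odd_nat)
  obtain c where c: "rat_cong p 1 c ((-1) ^ (p - 1 - 1) / of_nat (p - 1))"
    "(of_nat p * t gchoose (p - 1)) = of_nat p * (t * c)"
    using gbinomial_multiple_p_cong[OF p(1) t, of "p - 1"] p by auto
  \<comment> \<open>The odd exponent gives a minus sign, and \<open>- (p - 1)\<close> is 1 modulo
    \<open>p\<close>; hence \<open>c\<close> is congruent to 1.\<close>
  have "odd (p - 1 - 1)" using \<open>odd p\<close> p by auto
  then have "(-1 :: rat) ^ (p - 1 - 1) / of_nat (p - 1) = 1 / (- of_nat (p - 1))"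
    by (metis minus_divide_left minus_divide_right power_minus_odd power_one)
  moreover have "rat_cong p 1 (1 / (- of_nat (p - 1))) (1 / 1)"
  proof (rule rat_cong_inverse)
    have "rat_cong p 1 (of_nat p * (- 1) + 1) 1" by (intro rat_cong_add_multiple) auto
    then show "rat_cong p 1 (- of_nat (p - 1)) 1" using p by (simp add: of_nat_diff)
    have "p_integral p (- (1 / of_nat (p - 1)))"
      using p by (intro p_integral_minus p_integral_inverse_nat) auto
    then show "p_integral p (1 / (- of_nat (p - 1)))" by simp
  qed (use p in auto)
  ultimately have "rat_cong p 1 c 1" using c(1) by (auto intro: rat_cong_trans)
  with c(2) show ?case by auto
next
  case (Suc n)
  then obtain c where c: "rat_cong p 1 c (1 / of_nat (n + 1))"
    "(of_nat p * t + of_nat n gchoose (p - 1)) = of_nat p * (t * c)" by auto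
  define a where "a = of_nat p * t + (of_nat n :: rat)"
  define v where "v = of_nat p * (t - 1) + (of_nat (n + 2) :: rat)"
  have unit: "p_integral p (1 / of_nat (n + 2))" "p_integral p (1 / of_nat (n + 1))"
    using Suc.prems p by (auto intro!: p_integral_inverse_nat simp del: of_nat_add of_nat_Suc)
  have v_cong: "rat_cong p 1 v (of_nat (n + 2))"
    unfolding v_def using t by (intro rat_cong_add_multiple) auto
  \<comment> \<open>Over the denominator \<open>y\<close> of \<open>t - 1\<close>, the numerator of
    \<open>v\<close> is \<open>(n + 2) * y\<close> modulo \<open>p\<close>, hence prime to
    \<open>p\<close>; so \<open>v\<close> is invertible.\<close>
  obtain v0: "v \<noteq> 0" and v_inv: "p_integral p (1 / v)"
  proof -
    obtain x y where xy: "y \<noteq> 0" "coprime y (int p)" "t - 1 = of_int x / of_int y"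
      using p_integral_diff[OF t p_integral_numeral(2)] unfolding p_integral_iff by blast
    define z where "z = int p * x + int (n + 2) * y"
    have "coprime (int (n + 2)) (int p)"
      using Suc.prems p prime_imp_coprime[of p "n + 2"]
      by (auto simp: coprime_commute nat_dvd_not_less simp del: of_nat_add of_nat_Suc)
    then have "coprime (int (n + 2) * y) (int p)" using xy by simp
    then have z: "coprime z (int p)"
      unfolding z_def by (metis add.commute coprime_commute gcd_add_mult coprime_iff_gcd_eq_1 mult.commute)
    have vz: "v = of_int z / of_int y"
      unfolding v_def z_def xy using xy(1) by (simp add: field_simps)
    have "z \<noteq> 0" using z p by auto
    moreover have "p_integral p (1 / v)"
      unfolding vz using p_integral_mult[OF p_integral_of_int[of p y] p_integral_inverse_int[OF z]]
      by simp
    ultimately show ?thesis using vz xy that by auto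
  qed
  have ia: "p_integral p (1 + a)" unfolding a_def using t by auto
  have "(a + 1) * (a gchoose (p - 1)) = (a + 1 - of_nat (p - 1)) * (a + 1 gchoose (p - 1))"
    using gbinomial_absorb_comp[of "a + 1" "p - 1"] by simp
  also have "a + 1 - of_nat (p - 1) = v"
    unfolding a_def v_def using p by (simp add: of_nat_diff algebra_simps)
  finally have "(a + 1 gchoose (p - 1)) = of_nat p * (t * (c * (1 + a) * (1 / v)))"
    using v0 c(2) by (simp add: a_def field_simps)
  moreover have "rat_cong p 1 (c * (1 + a) * (1 / v)) (1 / of_nat (n + 1) * of_nat (n + 1) * (1 / of_nat (n + 2)))"
  proof (intro rat_cong_mult c)
    have "rat_cong p 1 (of_nat p * t + of_nat (n + 1)) (of_nat (n + 1))"
      using t by (intro rat_cong_add_multiple) auto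
    then show "rat_cong p 1 (1 + a) (of_nat (n + 1))" by (simp add: a_def add_ac)
    show "rat_cong p 1 (1 / v) (1 / of_nat (n + 2))"
      by (intro rat_cong_inverse v_cong v_inv unit v0) (metis of_nat_eq_0_iff add_2_eq_Suc' nat.distinct(1))
  qed
  ultimately show ?case
    by (intro exI[of _ "c * (1 + a) * (1 / v)"])
      (simp add: a_def add_ac del: of_nat_add)
qed

text \<open>The exact factor \<open>p\<close> allows \<open>2 ^ p\<close> to be replaced by 2, by
  Fermat. Then \<open>p / (n + 1)\<close> is read back as \<open>p choose (n + 1)\<close> up to the
  sign \<open>(-1) ^ n\<close>.\<close>

lemma gbinomial_top_cong_binomial:
  assumes p: "prime p" "p > 3" and t: "p_integral p t" and n: "n + 1 < p"
  shows "rat_cong p 2 (2 ^ p * (of_nat p * t + of_nat n gchoose (p - 1)))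
    (2 * t * (-1) ^ n * of_nat (p choose (n + 1)))"
proof -
  obtain c where c: "rat_cong p 1 c (1 / of_nat (n + 1))"
    "(of_nat p * t + of_nat n gchoose (p - 1)) = of_nat p * (t * c)"
    using gbinomial_top_cong[OF assms] by blast
  have "[2 ^ (p - 1) = 1] (mod p)"
    using p by (intro fermat_theorem) (auto dest: dvd_imp_le)
  then have "[2 * 2 ^ (p - 1) = 2 * 1] (mod p)" by (rule cong_scalar_left)
  then have "[2 ^ p = 2] (mod p)" using p by (simp flip: power_Suc)
  then have "[2 ^ p = 2] (mod int p)" by (metis cong_int_iff of_nat_numeral of_nat_power)
  then have two: "rat_cong p 1 (2 ^ p) 2" using rat_cong_of_int[of "2 ^ p" 2 p 1] by simp
  have "rat_cong p (Suc 1) (of_nat p * (t * (2 ^ p * c))) (of_nat p * (t * (2 * (1 / of_nat (n + 1)))))"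
    by (intro rat_cong_Suc rat_cong_mult two c rat_cong_refl t)
  then have 1: "rat_cong p 2 (2 ^ p * (of_nat p * t + of_nat n gchoose (p - 1)))
      (2 * t * (-1) ^ n * (of_nat p * ((-1) ^ (n + 1 - 1) / of_nat (n + 1))))"
    unfolding c(2) by (simp add: numeral_2_eq_2[symmetric] mult_ac flip: power_add mult_2)
  have "rat_cong p 2 (2 * t * (-1) ^ n * of_nat (p choose (n + 1)))
      (2 * t * (-1) ^ n * (of_nat p * ((-1) ^ (n + 1 - 1) / of_nat (n + 1))))"
    using t n by (intro rat_cong_mult binomial_p_cong p rat_cong_refl) auto
  with 1 show ?thesis by (blast intro: rat_cong_trans rat_cong_sym)
qed

section \<open>The truncated binomial series at -2\<close>

text \<open>For a natural number \<open>a < p\<close> this is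
  \<open>(1 - 2) ^ a = (-1) ^ a\<close>.\<close>

definition truncated_series :: "nat \<Rightarrow> rat \<Rightarrow> rat"
  where "truncated_series p a = (\<Sum>k = 0..p - 1. (a gchoose k) * (- 2) ^ k)"

lemma truncated_series_add_1:
  assumes "odd p"
  shows "truncated_series p (a + 1) = 2 ^ p * (a gchoose (p - 1)) - truncated_series p a"
proof -
  have "(\<Sum>k = 0..n. (a + 1 gchoose k) * (- 2) ^ k)
      = - (\<Sum>k = 0..n. (a gchoose k) * (- 2) ^ k) - (a gchoose n) * (- 2) ^ Suc n" for n
  proof (induction n)
    case (Suc n)
    show ?case unfolding sum.atLeast0_atMost_Suc Suc gbinomial_Suc_Suc by (simp add: algebra_simps)
  qed simp
  from this[of "p - 1"] assms show ?thesis
    by (cases p) (auto simp: truncated_series_def)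
qed

lemma sum_binomial_interior:
  fixes x :: rat
  assumes "p > 0"
  shows "(\<Sum>k = 1..p - 1. of_nat (p choose k) * x ^ k) = (1 + x) ^ p - 1 - x ^ p"
proof -
  have "(1 + x) ^ p = (\<Sum>k \<le> p. of_nat (p choose k) * x ^ k)"
    using binomial_ring[of x 1 p] by (simp add: add.commute)
  also have "{..p} = insert 0 (insert p {1..p - 1})" using assms by auto
  finally show ?thesis using assms by simp
qed

lemma truncated_series_multiple_p:
  assumes p: "prime p" "p > 3" and t: "p_integral p t"
  shows "rat_cong p 2 (truncated_series p (of_nat p * t)) (1 + t * (2 ^ p - 2))"
proof -
  have "odd p" using p by (simp add: prime_odd_nat)
  have *: "{0..p - 1} = insert 0 {1..p - 1}" by auto
  have "truncated_series p (of_nat p * t) = 1 + (\<Sum>k = 1..p - 1. (of_nat p * t gchoose k) * (- 2) ^ k)"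
    unfolding truncated_series_def * by simp
  also have "rat_cong p 2 \<dots> (1 + (\<Sum>k = 1..p - 1. t * of_nat (p choose k) * (- 2) ^ k))"
    using p by (intro rat_cong_add rat_cong_sum rat_cong_mult gbinomial_multiple_p_cong_binomial t) auto
  \<comment> \<open>The full binomial sum at -2 is -1; removing its end terms 1 and
    \<open>- (2 ^ p)\<close> leaves \<open>2 ^ p - 2\<close>.\<close>
  also have "(\<Sum>k = 1..p - 1. t * of_nat (p choose k) * (- 2) ^ k) = t * (2 ^ p - 2)"
    using sum_binomial_interior[of p "-2"] p \<open>odd p\<close>
    by (simp add: mult.assoc flip: sum_distrib_left)
  finally show ?thesis .
qed

lemma truncated_series_cong:
  assumes p: "prime p" "p > 3" and t: "p_integral p t" and n: "n < p"
  shows "rat_cong p 2 (truncated_series p (of_nat p * t + of_nat n))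
    ((-1) ^ n * (1 + t * (2 ^ p - 2) - 2 * t * (\<Sum>j = 1..n. of_nat (p choose j))))"
  using n
proof (induction n)
  case 0
  then show ?case using truncated_series_multiple_p[OF p t] by simp
next
  case (Suc n)
  have "odd p" using p by (simp add: prime_odd_nat)
  have "truncated_series p (of_nat p * t + of_nat (Suc n))
      = 2 ^ p * (of_nat p * t + of_nat n gchoose (p - 1))
        + - truncated_series p (of_nat p * t + of_nat n)"
    using truncated_series_add_1[OF \<open>odd p\<close>, of "of_nat p * t + of_nat n"] by (simp add: add_ac)
  also have "rat_cong p 2 \<dots> (2 * t * (-1) ^ n * of_nat (p choose (n + 1))
      + - ((-1) ^ n * (1 + t * (2 ^ p - 2) - 2 * t * (\<Sum>j = 1..n. of_nat (p choose j)))))"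
    using Suc by (intro rat_cong_add rat_cong_minus gbinomial_top_cong_binomial p t) auto
  \<comment> \<open>The new term carries the sign opposite to \<open>(-1) ^ Suc n\<close>, so it
    extends the subtracted partial sum.\<close>
  finally show ?case by (simp add: algebra_simps)
qed

section \<open>Binomial sums over the residue class 0 modulo 3\<close>

text \<open>\<open>c j\<close> is \<open>2 * cos (pi * j / 3)\<close>, the contribution of the two primitive cube roots of unity.\<close>

lemma sum_binomial_residue_mod_3:
  fixes n :: nat
  defines "c \<equiv> \<lambda>j. [2, 1, -1, -2, -1, 1 :: int] ! (j mod 6)"
    and "s \<equiv> \<lambda>r. \<Sum>k \<le> n. if k mod 3 = r then int (n choose k) else 0"
  shows "3 * s 0 = 2 ^ n + c n" "3 * s 1 = 2 ^ n + c (n + 4)" "3 * s 2 = 2 ^ n + c (n + 2)"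
proof -
  \<comment> \<open>For \<open>2 * cos (pi * j / 3)\<close> this is the sum-to-product formula with
    \<open>2 * cos (pi / 3) = 1\<close>, together with periodicity.\<close>
  have c_step: "c (j + 1) = c j + c (j + 2)" "c (j + 6) = c j" for j
  proof -
    define r where "r = j mod 6"
    have r: "r \<in> {0, 1, 2, 3, 4, 5}" unfolding r_def by auto
    have c: "c (j + i) = [2, 1, -1, -2, -1, 1] ! ((r + i) mod 6)" for i
      unfolding c_def r_def by (simp only: mod_add_left_eq)
    show "c (j + 1) = c j + c (j + 2)" "c (j + 6) = c j"
      using r c[of 0] c[of 1] c[of 2] c[of 6] by (auto simp del: add_2_eq_Suc')
  qed
  define S where "S n r = (\<Sum>k \<le> n. if k mod 3 = r then int (n choose k) else 0)" for n r
  \<comment> \<open>Pascal's rule; \<open>(r + 2) mod 3\<close> is the residue \<open>r - 1\<close>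
    without subtraction on naturals.\<close>
  have S_step: "S (Suc n) r = S n r + S n ((r + 2) mod 3)" if "r < 3" for n r
  proof -
    \<comment> \<open>The term at \<open>k = 0\<close> is split off and later reabsorbed into the
      sum of \<open>n choose k\<close>, whose extra top term vanishes.\<close>
    have "S (Suc n) r = (if r = 0 then 1 else 0)
        + (\<Sum>k \<le> n. if Suc k mod 3 = r then int (n choose k) + int (n choose Suc k) else 0)"
      unfolding S_def by (subst sum.atMost_Suc_shift) (auto intro!: sum.cong)
    also have "\<dots> = (if r = 0 then 1 else 0)
        + (\<Sum>k \<le> n. if Suc k mod 3 = r then int (n choose Suc k) else 0)
        + (\<Sum>k \<le> n. if Suc k mod 3 = r then int (n choose k) else 0)"
      unfolding add.assoc sum.distrib[symmetric]
      by (intro arg_cong2[where f = "(+)"] refl sum.cong) auto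
    also have "(if r = 0 then 1 else 0)
        + (\<Sum>k \<le> n. if Suc k mod 3 = r then int (n choose Suc k) else 0)
        = (\<Sum>k \<le> Suc n. if k mod 3 = r then int (n choose k) else 0)"
      by (subst sum.atMost_Suc_shift) auto
    also have "\<dots> = S n r" unfolding S_def by (simp add: binomial_eq_0)
    also have "(\<Sum>k \<le> n. if Suc k mod 3 = r then int (n choose k) else 0) = S n ((r + 2) mod 3)"
    proof -
      have "r = 0 \<or> r = 1 \<or> r = 2" using that by auto
      then have "Suc k mod 3 = r \<longleftrightarrow> k mod 3 = (r + 2) mod 3" for k
        by (elim disjE; hypsubst; simp; presburger)
      then show ?thesis unfolding S_def by simp
    qed
    finally show ?thesis .
  qed
  have "3 * S n 0 = 2 ^ n + c n \<and> 3 * S n 1 = 2 ^ n + c (n + 4) \<and> 3 * S n 2 = 2 ^ n + c (n + 2)" for n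
  proof (induction n)
    case 0
    show ?case by (simp add: S_def c_def)
  next
    case (Suc n)
    \<comment> \<open>The second identity needs the period: \<open>c (n + 6)\<close> is
      \<open>c n\<close>.\<close>
    have "c (Suc n) = c n + c (n + 2)" "c (Suc n + 4) = c (n + 4) + c n"
      "c (Suc n + 2) = c (n + 2) + c (n + 4)"
      using c_step(1)[of n] c_step(1)[of "n + 4"] c_step(1)[of "n + 2"] c_step(2)[of n]
      by (simp_all add: eval_nat_numeral)
    moreover have "S (Suc n) 0 = S n 0 + S n 2" "S (Suc n) 1 = S n 1 + S n 0"
      "S (Suc n) 2 = S n 2 + S n 1"
      using S_step[of 0 n] S_step[of 1 n] S_step[of 2 n]
      by (simp_all flip: numeral_2_eq_2)
    ultimately show ?case using Suc.IH by simp
  qed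
  then show "3 * s 0 = 2 ^ n + c n" "3 * s 1 = 2 ^ n + c (n + 4)" "3 * s 2 = 2 ^ n + c (n + 2)"
    unfolding s_def S_def by blast+
qed

lemma prime_gt_3_not_dvd:
  fixes p :: nat
  assumes "prime p" "p > 3"
  shows "\<not> 3 dvd p"
  using assms by (auto simp: prime_nat_iff)

text \<open>A prime above 3 is 1 or 5 modulo 6, where the root-of-unity contribution is 1; dropping
  the term at 0 lowers \<open>2 ^ p + 1\<close> by 3.\<close>

lemma sum_binomial_multiples_3:
  assumes "prime p" "p > 3"
  shows "3 * (\<Sum>k = 1..p div 3. of_nat (p choose (3 * k))) = (2 ^ p - 2 :: rat)"
proof -
  have "odd p" using assms by (simp add: prime_odd_nat)
  moreover have "\<not> 3 dvd p" by (rule prime_gt_3_not_dvd[OF assms])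
  ultimately have "p mod 6 = 1 \<or> p mod 6 = 5" by presburger
  then have "3 * (\<Sum>k \<le> p. if k mod 3 = 0 then int (p choose k) else 0) = 2 ^ p + 1"
    unfolding sum_binomial_residue_mod_3(1) by auto
  also have "(\<Sum>k \<le> p. if k mod 3 = 0 then int (p choose k) else 0)
      = (\<Sum>k \<in> {k \<in> {..p}. k mod 3 = 0}. int (p choose k))"
    by (intro sum.inter_filter[symmetric]) auto
  also have "{k \<in> {..p}. k mod 3 = 0} = (*) 3 ` {0..p div 3}"
    by (auto simp: image_iff)
  also have "(\<Sum>k \<in> (*) 3 ` {0..p div 3}. int (p choose k)) = (\<Sum>k = 0..p div 3. int (p choose (3 * k)))"
    by (subst sum.reindex) (auto simp: inj_on_def)
  also have "{0..p div 3} = insert 0 {1..p div 3}" by auto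
  finally have "3 * (\<Sum>k = 1..p div 3. int (p choose (3 * k))) = 2 ^ p - 2" by simp
  then have "(of_int (3 * (\<Sum>k = 1..p div 3. int (p choose (3 * k)))) :: rat) = of_int (2 ^ p - 2)"
    by (simp only:)
  then show ?thesis by simp
qed

text \<open>Since \<open>k\<close> and \<open>3 * k\<close> have the same parity, \<open>3 * (p choose (3 * k))\<close> and \<open>p choose k\<close>
  are congruent to the same \<open>- p * (-1) ^ k / k\<close>.\<close>

lemma sum_binomial_third_cong:
  assumes p: "prime p" "p > 3"
  shows "rat_cong p 2 (\<Sum>j = 1..p div 3. of_nat (p choose j)) (2 ^ p - 2)"
proof -
  have "rat_cong p 2 (of_nat (p choose k)) (3 * of_nat (p choose (3 * k)))"
    if k: "k \<in> {1..p div 3}" for k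
  proof -
    \<comment> \<open>Strictness \<open>3 * k < p\<close> is what makes
      \<open>binomial_p_cong\<close> applicable at \<open>3 * k\<close>.\<close>
    have "3 * k \<noteq> p" using prime_gt_3_not_dvd[OF p] by auto
    moreover have "3 * k \<le> p" using k by auto
    ultimately have lt: "3 * k < p" by simp
    have e: "(-1 :: rat) ^ (3 * k - 1) = (-1) ^ (k - 1)"
    proof -
      have "3 * k - 1 = (k - 1) + 2 * k" using k by auto
      then show ?thesis by (simp only: power_add power_mult) simp
    qed
    have "rat_cong p 2 (of_nat (p choose k)) (of_nat p * ((-1) ^ (k - 1) / of_nat k))"
      using k lt by (intro binomial_p_cong p) auto
    also have "of_nat p * ((-1) ^ (k - 1) / of_nat k)
        = 3 * (of_nat p * ((-1) ^ (3 * k - 1) / (of_nat (3 * k) :: rat)))"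
      unfolding e by simp
    also have "rat_cong p 2 \<dots> (3 * of_nat (p choose (3 * k)))"
      using k lt by (intro rat_cong_mult rat_cong_sym[OF binomial_p_cong] p) auto
    finally show ?thesis .
  qed
  then have "rat_cong p 2 (\<Sum>j = 1..p div 3. of_nat (p choose j))
      (\<Sum>j = 1..p div 3. 3 * of_nat (p choose (3 * j)))"
    by (intro rat_cong_sum)
  then show ?thesis using sum_binomial_multiples_3[OF p] by (simp add: sum_distrib_left)
qed

text \<open>The reflection of \<open>j\<close> to \<open>p - j\<close> identifies the first
  \<open>m\<close> interior coefficients with the last \<open>m\<close>, and all interior ones add
  up to \<open>2 ^ p - 2\<close>.\<close>

lemma sum_binomial_complement:
  assumes "m < p"
  shows "(\<Sum>j = 1..p - 1 - m. of_nat (p choose j))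
    = (2 ^ p - 2 :: rat) - (\<Sum>j = 1..m. of_nat (p choose j))"
proof -
  have "(\<Sum>j = 1..m. of_nat (p choose j) :: rat) = (\<Sum>j = p - m..p - 1. of_nat (p choose j))"
    using assms
    by (intro sum.reindex_bij_witness[of _ "\<lambda>j. p - j" "\<lambda>j. p - j"])
      (auto simp: binomial_symmetric[symmetric])
  moreover have "{1..p - 1} = {1..p - 1 - m} \<union> {p - m..p - 1}" using assms by auto
  then have "(\<Sum>j = 1..p - 1. of_nat (p choose j) :: rat)
      = (\<Sum>j = 1..p - 1 - m. of_nat (p choose j)) + (\<Sum>j = p - m..p - 1. of_nat (p choose j))"
    by (simp only:) (intro sum.union_disjoint, auto)
  ultimately show ?thesis
    using sum_binomial_interior[of p 1] assms by simp
qed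

section \<open>The Legendre symbol of -3 and the evaluation at -1/3\<close>

text \<open>The sign \<open>(-1) ^ h\<close> from reciprocity between 3 and \<open>p\<close> cancels
  the one that Euler's criterion yields for the factor -1, leaving the symbol of \<open>p\<close>
  modulo 3.\<close>

lemma Legendre_minus_3:
  assumes p: "prime p" "p > 3"
  shows "Legendre (- 3) (int p) = (if p mod 3 = 1 then 1 else - 1)"
proof -
  define h where "h = (p - 1) div 2"
  have n3: "\<not> 3 dvd p" by (rule prime_gt_3_not_dvd[OF p])
  have L3: "Legendre (int p) 3 = (if p mod 3 = 1 then 1 else - 1)"
  proof (cases "p mod 3 = 1")
    case True
    then have p1: "int p mod 3 = 1" by presburger
    then have "QuadRes 3 (int p)" unfolding QuadRes_def by (intro exI[of _ 1]) (simp add: cong_def)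
    then show ?thesis using True p1 by (simp add: Legendre_def cong_def)
  next
    case False
    then have p2: "int p mod 3 = 2" using n3 by presburger
    have "(y ^ 2) mod 3 \<noteq> 2" for y :: int
    proof -
      have "y mod 3 \<in> {0, 1, 2}" by auto
      then show ?thesis by (subst power_mod[symmetric]) auto
    qed
    then show ?thesis using False p2 unfolding Legendre_def QuadRes_def cong_def by simp
  qed
  have "Legendre (int p) (int 3) * Legendre (int 3) (int p) = (- 1) ^ (h * ((3 - 1) div 2))"
    unfolding h_def using p by (intro Quadratic_Reciprocity) auto
  then have "Legendre (int p) 3 * Legendre 3 (int p) = (- 1) ^ h" by simp
  moreover have "Legendre (int p) 3 * Legendre (int p) 3 = 1" unfolding L3 by simp
  moreover have "((- 1) ^ h * (- 1) ^ h :: int) = 1" by (simp flip: power_mult_distrib)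
  ultimately have rec: "(- 1) ^ h * Legendre 3 (int p) = Legendre (int p) 3"
    by (metis mult.assoc mult.commute mult_1)
  have "[Legendre (- 3) (int p) = (- 3) ^ h] (mod p)"
    unfolding h_def using p by (intro euler_criterion) auto
  also have "(- 3 :: int) ^ h = (- 1) ^ h * 3 ^ h" by (simp flip: power_mult_distrib)
  also have "[\<dots> = (- 1) ^ h * Legendre 3 (int p)] (mod p)"
    unfolding h_def using p by (intro cong_scalar_left cong_sym[OF euler_criterion]) auto
  finally have "[Legendre (- 3) (int p) = Legendre (int p) 3] (mod p)" unfolding rec .
  then have "int p dvd Legendre (- 3) (int p) - Legendre (int p) 3"
    by (simp add: cong_iff_dvd_diff)
  \<comment> \<open>Symbols differ by at most 2, which is less than \<open>p\<close>, so their
    congruence is an equality.\<close>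
  moreover have "\<bar>Legendre (- 3) (int p) - Legendre (int p) 3\<bar> < int p"
    using p by (auto simp: Legendre_def)
  ultimately have "Legendre (- 3) (int p) = Legendre (int p) 3"
    using dvd_imp_le_int[of "Legendre (- 3) (int p) - Legendre (int p) 3" "int p"] by linarith
  then show ?thesis using L3 by simp
qed

section \<open>Evaluation at -1/3 according to \<open>p\<close> modulo 3\<close>

theorem theorem7p2:
  fixes p :: nat
  assumes "prime p" and "p > 3"
  shows "rat_cong p 2
    (\<Sum>k = 0..p - 1. ((- 1 / 3 :: rat) gchoose k) * (- 2) ^ k)
    (of_int (Legendre (- 3) (int p))
      + (3 - of_int (Legendre (- 3) (int p))) / 3 * of_nat p * fermat_quotient p 2)"
proof -
  \<comment> \<open>\<open>D\<close> is twice \<open>p\<close> times the Fermat quotient.\<close>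
  define D where "D = (2 ^ p - 2 :: rat)"
  define m where "m = p div 3"
  have m: "m < p" unfolding m_def using assms by auto
  have "odd p" using assms by (simp add: prime_odd_nat)
  have n3: "\<not> 3 dvd p" by (rule prime_gt_3_not_dvd[OF assms])
  have third: "p_integral p (1 / 3)" using p_integral_inverse_nat[of p 3] assms by simp
  have "2 ^ p = (2 * 2 ^ (p - 1) :: rat)" using assms by (simp flip: power_Suc)
  then have q: "of_nat p * fermat_quotient p 2 = D / 2"
    using assms by (simp add: fermat_quotient_def D_def)
  have G: "rat_cong p 2 (\<Sum>j = 1..m. of_nat (p choose j)) D"
    unfolding m_def D_def by (rule sum_binomial_third_cong[OF assms])
  have D: "p_integral p D" unfolding D_def by auto
  show ?thesis
  proof (cases "p mod 3 = 1")
    case True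
    then have pm: "p = 3 * m + 1" unfolding m_def by presburger
    then have "even m" using \<open>odd p\<close> by auto
    \<comment> \<open>From \<open>p = 3 * m + 1\<close> one gets \<open>-1/3 = p * t + m\<close>
      with \<open>t = -1/3\<close>; the even \<open>m\<close> gives the sign +1.\<close>
    have "rat_cong p 2 (truncated_series p (of_nat p * (- (1 / 3)) + of_nat m))
        ((-1) ^ m * (1 + - (1 / 3) * (2 ^ p - 2) - 2 * - (1 / 3) * (\<Sum>j = 1..m. of_nat (p choose j))))"
      using assms third m by (intro truncated_series_cong) auto
    also have "of_nat p * (- (1 / 3)) + of_nat m = (- 1 / 3 :: rat)"
      unfolding pm by (simp add: field_simps)
    also have "(-1) ^ m * (1 + - (1 / 3) * (2 ^ p - 2) - 2 * - (1 / 3) * (\<Sum>j = 1..m. of_nat (p choose j)))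
        = 1 - D / 3 + 2 * (1 / 3) * (\<Sum>j = 1..m. of_nat (p choose j))"
      using \<open>even m\<close> by (simp add: D_def)
    also have "rat_cong p 2 \<dots> (1 - D / 3 + 2 * (1 / 3) * D)"
      using D third p_integral_mult[OF D third]
      by (intro rat_cong_add rat_cong_mult G rat_cong_refl p_integral_diff) auto
    also have "1 - D / 3 + 2 * (1 / 3) * D = 1 + (3 - 1) / 3 * of_nat p * fermat_quotient p 2"
      by (simp add: mult.assoc q)
    finally show ?thesis
      using True by (simp add: Legendre_minus_3[OF assms] truncated_series_def)
  next
    case False
    then have pm: "p = 3 * m + 2" unfolding m_def using n3 by presburger
    have n: "p - 1 - m = 2 * m + 1" using pm by simp
    \<comment> \<open>From \<open>p = 3 * m + 2\<close> one gets
      \<open>-1/3 = p * t + (2 * m + 1)\<close> with \<open>t = -2/3\<close>. The odd shift gives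
      the sign -1, and being \<open>p - 1 - m\<close> it lets the complement formula reduce the
      partial sum to length \<open>m\<close>.\<close>
    have "rat_cong p 2 (truncated_series p (of_nat p * (- (2 * (1 / 3))) + of_nat (2 * m + 1)))
        ((-1) ^ (2 * m + 1) * (1 + - (2 * (1 / 3)) * (2 ^ p - 2)
          - 2 * - (2 * (1 / 3)) * (\<Sum>j = 1..2 * m + 1. of_nat (p choose j))))"
      using pm by (intro truncated_series_cong assms p_integral_minus p_integral_mult third) auto
    also have "of_nat p * (- (2 * (1 / 3))) + of_nat (2 * m + 1) = (- 1 / 3 :: rat)"
      unfolding pm by (simp add: field_simps)
    also have "(\<Sum>j = 1..2 * m + 1. of_nat (p choose j)) = D - (\<Sum>j = 1..m. of_nat (p choose j))"
      using sum_binomial_complement[OF m] unfolding n D_def .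
    also have "(-1) ^ (2 * m + 1) * (1 + - (2 * (1 / 3)) * (2 ^ p - 2)
          - 2 * - (2 * (1 / 3)) * (D - (\<Sum>j = 1..m. of_nat (p choose j))))
        = - 1 - 2 * D * (1 / 3) + 4 * (1 / 3) * (\<Sum>j = 1..m. of_nat (p choose j))"
      by (simp add: D_def field_simps)
    also have "rat_cong p 2 \<dots> (- 1 - 2 * D * (1 / 3) + 4 * (1 / 3) * D)"
      using D third
      by (intro rat_cong_add rat_cong_mult G rat_cong_refl p_integral_diff p_integral_mult
          p_integral_minus) auto
    also have "- 1 - 2 * D * (1 / 3) + 4 * (1 / 3) * D
        = - 1 + (3 - (- 1)) / 3 * of_nat p * fermat_quotient p 2"
      by (simp add: mult.assoc q)
    finally show ?thesis
      using False by (simp add: Legendre_minus_3[OF assms] truncated_series_def)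
  qed
qed

end
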